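(* Let $\mathcal{F}=\{\Delta\in\mathbb{R}^{m\times q} : \Delta S^{\dagger}=0\}$ and $\mathcal{K}=\{K\in\mathbb{R}^{m\times q} : K=K^*+\Delta,\ \Delta\in\mathcal{F}\}$. Then $K$ is an optimal policy of the problem of minimizing $J(K)$ over $K\in\mathcal{S}$ if and only if $K\in\mathcal{K}$.
   Context: System: $x_{t+1}=Ax_t+Bu_t$, $y_t=Cx_t$, with $x_t\in\mathbb{R}^n$, $u_t\in\mathbb{R}^m$, $y_t\in\mathbb{R}^d$. Standing assumptions: $(A,B)$ is controllable and $(C,A)$ is observable; the weights are symmetric, $Q\ge 0$ (size $d\times d$) and $R>0$ (size $m\times m$); the initial state $x_0$ is random with zero mean and covariance $\Sigma_0=\mathbb{E}[x_0x_0^\top]>0$. Let $p=\max\{o,c\}\le n$, where $o$ and $c$ are the observability and controllability indices, so that $\mathcal{O}=[(CA^{p-1})^\top,\dots,(CA)^\top,C^\top]^\top$ has full column rank and $\mathcal{C}=[B,AB,\dots,A^{p-1}B]$ has full row rank. Let $\mathcal{T}$ be the $p\times p$ block matrix with blocks in $\mathbb{R}^{d\times m}$ whose $(i,j)$ block is $CA^{j-i-1}B$ if $j>i$ and $0$ otherwise. Let $\mathcal{O}^\dagger=(\mathcal{O}^\top\mathcal{O})^{-1}\mathcal{O}^\top$, $q=p(m+d)$, and $$S=[\,\mathcal{C}-A^p\mathcal{O}^\dagger\mathcal{T},\ A^p\mathcal{O}^\dagger\,]\in\mathbb{R}^{n\times q}.$$ $S$ has full row rank; put $S^\dagger=S^\top(SS^\top)^{-1}$.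 With $z_{t,p}=[u_{t-1}^\top,\dots,u_{t-p}^\top,y_{t-1}^\top,\dots,y_{t-p}^\top]^\top$ one has $x_t=Sz_{t,p}$. The policies considered are $u_t=-Kz_{t,p}$ with $K\in\mathbb{R}^{m\times q}$ (input-output feedback), and the feasible set is $\mathcal{S}=\{K\in\mathbb{R}^{m\times q} : \rho(A-BKS^\dagger)<1\}$, where $\rho$ is the spectral radius. Put $Q_c=C^\top QC$. For $K\in\mathcal{S}$ the cost (of $\sum_{t\ge0}(y_t^\top Qy_t+u_t^\top Ru_t)$ in expectation over $x_0$) is given by $J(K)=\mathrm{Tr}(P_K\Sigma_0)$, where $P_K\ge0$ is the solution of $P_K=Q_c+(S^\dagger)^\top K^\top RKS^\dagger+(A-BKS^\dagger)^\top P_K(A-BKS^\dagger)$. $P^*$ is the unique positive semidefinite solution of the Riccati equation $P^*=A^\top P^*A+Q_c-A^\top P^*B(R+B^\top P^*B)^{-1}B^\top P^*A$, and $K^*=(R+B^\top P^*B)^{-1}B^\top P^*AS$, which is an optimal policy (in particular $K^*\in\mathcal{S}$). An optimal policy is a $K\in\mathcal{S}$ with $J(K)\le J(K')$ for all $K'\in\mathcal{S}$. *)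

theory Defs
  imports
    "HOL-Probability.Probability"
    "Jordan_Normal_Form.Gauss_Jordan_Elimination"
    "Jordan_Normal_Form.DL_Rank"
    "Jordan_Normal_Form.Spectral_Radius"
begin

no_notation vec_nth (infixl \<open>$\<close> 90)
no_notation inner (infix \<open>\<bullet>\<close> 70)

definition pos_semidef :: "nat \<Rightarrow> real mat \<Rightarrow> bool" where
  "pos_semidef k P \<longleftrightarrow>
     P \<in> carrier_mat k k \<and> P\<^sup>T = P \<and> (\<forall>x \<in> carrier_vec k. x \<bullet> (P *\<^sub>v x) \<ge> 0)"

definition pos_def :: "nat \<Rightarrow> real mat \<Rightarrow> bool" where
  "pos_def k P \<longleftrightarrow>
     P \<in> carrier_mat k k \<and> P\<^sup>T = P \<and> (\<forall>x \<in> carrier_vec k. x \<noteq> 0\<^sub>v k \<longrightarrow> x \<bullet> (P *\<^sub>v x) > 0)"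

definition tr :: "real mat \<Rightarrow> real" where
  "tr M = (\<Sum>i<dim_row M. M $$ (i, i))"

text \<open>Only meaningful for invertible matrices; unspecified otherwise.\<close>

definition minv :: "real mat \<Rightarrow> real mat" where
  "minv M = the (mat_inverse M)"

abbreviation spec_rad :: "real mat \<Rightarrow> real" where
  "spec_rad M \<equiv> spectral_radius (map_mat complex_of_real M)"

text \<open>A random vector in \<open>\<real>\<^sup>n\<close> with square-integrable components and mean zero.\<close>

definition centered_random_vec :: "nat \<Rightarrow> 'w measure \<Rightarrow> ('w \<Rightarrow> real vec) \<Rightarrow> bool" where
  "centered_random_vec n M x \<longleftrightarrow>
     (\<forall>\<omega> \<in> space M. x \<omega> \<in> carrier_vec n) \<and>
     (\<forall>i<n. (\<lambda>\<omega>. x \<omega> $ i) \<in> borel_measurable M \<and>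
            integrable M (\<lambda>\<omega>. (x \<omega> $ i)\<^sup>2) \<and>
            (\<integral>\<omega>. x \<omega> $ i \<partial>M) = 0)"

definition covariance_mat :: "nat \<Rightarrow> 'w measure \<Rightarrow> ('w \<Rightarrow> real vec) \<Rightarrow> real mat" where
  "covariance_mat n M x = mat n n (\<lambda>(i, j). \<integral>\<omega>. x \<omega> $ i * x \<omega> $ j \<partial>M)"

text \<open>
  The locale only fixes the data; it carries no assumptions. The system is
  \<open>x\<^sub>t\<^sub>+\<^sub>1 = A x\<^sub>t + B u\<^sub>t\<close>, \<open>y\<^sub>t = C x\<^sub>t\<close> with state, input and output dimensions \<open>n\<close>, \<open>m\<close>, \<open>d\<close>.
  Block rows and block columns are numbered from 0, so that entry \<open>i\<close> of a stack of blocks of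
  height \<open>h\<close> is entry \<open>i mod h\<close> of block \<open>i div h\<close>.
\<close>

locale io_lqr =
  fixes n m d :: nat
    and A B C Q R \<Sigma>0 :: "real mat"
begin

definition obs_mat :: "nat \<Rightarrow> real mat" where
  "obs_mat k = mat (k * d) n (\<lambda>(i, j). (C * A ^\<^sub>m (k - 1 - i div d)) $$ (i mod d, j))"

definition ctrb_mat :: "nat \<Rightarrow> real mat" where
  "ctrb_mat k = mat n (k * m) (\<lambda>(i, j). (A ^\<^sub>m (j div m) * B) $$ (i, j mod m))"

definition observable :: bool where
  "observable \<longleftrightarrow> vec_space.rank (n * d) (obs_mat n) = n"

definition controllable :: bool where
  "controllable \<longleftrightarrow> vec_space.rank n (ctrb_mat n) = n"

definition obs_index :: nat where
  "obs_index = (LEAST k. vec_space.rank (k * d) (obs_mat k) = n)"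

definition ctrb_index :: nat where
  "ctrb_index = (LEAST k. vec_space.rank n (ctrb_mat k) = n)"

definition p :: nat where
  "p = max obs_index ctrb_index"

definition q :: nat where
  "q = p * (m + d)"

definition toeplitz_mat :: "real mat" where
  "toeplitz_mat = mat (p * d) (p * m)
     (\<lambda>(i, j). if j div m > i div d
               then (C * A ^\<^sub>m (j div m - i div d - 1) * B) $$ (i mod d, j mod m)
               else 0)"

definition obs_pinv :: "real mat" where
  "obs_pinv = minv ((obs_mat p)\<^sup>T * obs_mat p) * (obs_mat p)\<^sup>T"

definition S :: "real mat" where
  "S = mat n q (\<lambda>(i, j).
         if j < p * m then (ctrb_mat p - A ^\<^sub>m p * obs_pinv * toeplitz_mat) $$ (i, j)
         else (A ^\<^sub>m p * obs_pinv) $$ (i, j - p * m))"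

definition S_pinv :: "real mat" where
  "S_pinv = S\<^sup>T * minv (S * S\<^sup>T)"

definition closed_loop :: "real mat \<Rightarrow> real mat" where
  "closed_loop K = A - B * K * S_pinv"

definition feasible :: "real mat set" where
  "feasible = {K \<in> carrier_mat m q. spec_rad (closed_loop K) < 1}"

definition Qc :: "real mat" where
  "Qc = C\<^sup>T * Q * C"

text \<open>For feasible \<open>K\<close> the description below is proper, since \<open>closed_loop K\<close> is Schur stable.\<close>

definition cost_mat :: "real mat \<Rightarrow> real mat" where
  "cost_mat K = (THE P. pos_semidef n P \<and>
     P = Qc + S_pinv\<^sup>T * K\<^sup>T * R * K * S_pinv + (closed_loop K)\<^sup>T * P * closed_loop K)"

definition J :: "real mat \<Rightarrow> real" where
  "J K = tr (cost_mat K * \<Sigma>0)"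

definition optimal_policy :: "real mat \<Rightarrow> bool" where
  "optimal_policy K \<longleftrightarrow> K \<in> feasible \<and> (\<forall>K' \<in> feasible. J K \<le> J K')"

definition riccati_solution :: "real mat \<Rightarrow> bool" where
  "riccati_solution P \<longleftrightarrow> pos_semidef n P \<and>
     P = A\<^sup>T * P * A + Qc - A\<^sup>T * P * B * minv (R + B\<^sup>T * P * B) * B\<^sup>T * P * A"

definition riccati_gain :: "real mat \<Rightarrow> real mat" where
  "riccati_gain P = minv (R + B\<^sup>T * P * B) * B\<^sup>T * P * A * S"

definition null_policies :: "real mat set" where
  "null_policies = {\<Delta> \<in> carrier_mat m q. \<Delta> * S_pinv = 0\<^sub>m m n}"

definition policy_family :: "real mat \<Rightarrow> real mat set" where
  "policy_family K0 = {K \<in> carrier_mat m q. \<exists>\<Delta> \<in> null_policies. K = K0 + \<Delta>}"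

end

end

theory Submission
  imports Defs
begin

text \<open>
  The cost of a policy \<open>K\<close> depends on \<open>K\<close> only through the induced state feedback
  \<open>L = K S\<^sup>\<dagger>\<close>. Since \<open>S\<close> has full row rank, \<open>S S\<^sup>\<dagger> = 1\<close> (\<open>S_right_inverse\<close>), so
  \<open>K\<^sup>* = F S\<close> induces the Riccati feedback \<open>F = (R + B\<^sup>T P\<^sup>* B)\<^sup>-\<^sup>1 B\<^sup>T P\<^sup>* A\<close>, and \<open>K\<close> lies
  in the family \<open>K\<^sup>* + \<F>\<close> if and only if \<open>K S\<^sup>\<dagger> = F\<close>. It remains to see that \<open>F\<close> is the
  only optimal value of \<open>L\<close>.

  Put \<open>G = R + B\<^sup>T P\<^sup>* B\<close> and \<open>T = A - B L\<close>. Completing the square in the Riccati equation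
  (\<open>riccati_completion_of_squares\<close>) shows that \<open>P\<^sup>*\<close> satisfies the Lyapunov equation of \<open>L\<close> up
  to the defect \<open>W = (L - F)\<^sup>T G (L - F)\<close>. For a stable \<open>T\<close>, Lyapunov equations have exactly
  one solution, and it is positive semidefinite if the constant term is
  (\<open>lyapunov_exists\<close>, \<open>lyapunov_unique\<close>). Hence the cost matrix of \<open>K\<close> is \<open>P\<^sup>* + D\<close>, where
  \<open>D = W + T\<^sup>T D T\<close> is positive semidefinite, and so \<open>D \<ge> W\<close>.

  Finally \<open>Tr (X \<Sigma>\<^sub>0)\<close> is the expectation of \<open>x\<^sub>0\<^sup>T X x\<^sub>0\<close> (\<open>trace_covariance\<close>). So
  \<open>J(K) - Tr (P\<^sup>* \<Sigma>\<^sub>0)\<close> is at least the expectation of \<open>((L - F) x\<^sub>0)\<^sup>T G ((L - F) x\<^sub>0) \<ge> 0\<close>.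
  If this vanishes, then \<open>(L - F) x\<^sub>0 = 0\<close> almost surely because \<open>G > 0\<close>, and then \<open>L = F\<close>
  because the covariance of \<open>x\<^sub>0\<close> is nondegenerate (\<open>trace_covariance_eq_0\<close>). Conversely
  \<open>L = F\<close> makes the defect vanish, so the cost is exactly \<open>Tr (P\<^sup>* \<Sigma>\<^sub>0)\<close>.
\<close>

section \<open>Matrix inverses, rank and bilinear forms\<close>

lemma minv_inverse:
  assumes M: "M \<in> carrier_mat k k"
    and inj: "\<And>v. v \<in> carrier_vec k \<Longrightarrow> M *\<^sub>v v = 0\<^sub>v k \<Longrightarrow> v = 0\<^sub>v k"
  shows "minv M \<in> carrier_mat k k" "M * minv M = 1\<^sub>m k" "minv M * M = 1\<^sub>m k"
proof -
  have "det M \<noteq> 0"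
    using inj det_0_iff_vec_prod_zero_field[OF M] by blast
  then have "M \<in> Units (ring_mat TYPE(real) k ())"
    by (rule det_non_zero_imp_unit[OF M])
  then have "mat_inverse M \<noteq> None"
    using mat_inverse(1)[OF M, where b = "()"] by blast
  then have "mat_inverse M = Some (minv M)"
    by (simp add: minv_def)
  from mat_inverse(2)[OF M this]
  show "minv M \<in> carrier_mat k k" "M * minv M = 1\<^sub>m k" "minv M * M = 1\<^sub>m k"
    by auto
qed

lemma pos_def_minv:
  assumes "pos_def k M"
  shows "minv M \<in> carrier_mat k k" "M * minv M = 1\<^sub>m k" "minv M * M = 1\<^sub>m k"
proof -
  have M: "M \<in> carrier_mat k k"
    using assms by (simp add: pos_def_def)
  have inj: "v = 0\<^sub>v k" if "v \<in> carrier_vec k" "M *\<^sub>v v = 0\<^sub>v k" for v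
    using assms that by (auto simp: pos_def_def)
  show "minv M \<in> carrier_mat k k" "M * minv M = 1\<^sub>m k" "minv M * M = 1\<^sub>m k"
    using minv_inverse[OF M inj] by auto
qed

lemma scalar_prod_self_eq_0:
  fixes v :: "real vec"
  assumes "v \<bullet> v = 0"
  shows "v = 0\<^sub>v (dim_vec v)"
proof (rule eq_vecI)
  fix i assume "i < dim_vec (0\<^sub>v (dim_vec v) :: real vec)"
  then have i: "i \<in> {0..<dim_vec v}" by simp
  have "(\<Sum>i = 0..<dim_vec v. v $ i * v $ i) = 0"
    using assms by (simp add: scalar_prod_def)
  then have "v $ i * v $ i = 0"
    using i by (subst (asm) sum_nonneg_eq_0_iff) auto
  then show "v $ i = 0\<^sub>v (dim_vec v) $ i"
    using i by simp
qed simp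

text \<open>
  A maximal independent set of columns has \<open>n\<close> members. They form an invertible square matrix,
  whose transpose annihilates any vector orthogonal to all columns.
\<close>

lemma full_row_rank_imp_left_kernel_trivial:
  fixes A :: "real mat"
  assumes A: "A \<in> carrier_mat n k" and rank: "vec_space.rank n A = n"
    and v: "v \<in> carrier_vec n" and orth: "\<And>j. j < k \<Longrightarrow> col A j \<bullet> v = 0"
  shows "v = 0\<^sub>v n"
proof -
  interpret vec_space "TYPE(real)" n .
  obtain U where max: "maximal U (\<lambda>T. T \<subseteq> set (cols A) \<and> lin_indpt T)"
    using maximal_exists[of "(\<lambda>T. T \<subseteq> set (cols A) \<and> lin_indpt T)" "card (set (cols A))" "{}"]
    by (meson List.finite_set card_mono empty_iff empty_subsetI finite_lin_indpt2 rev_finite_subset)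
  then have U: "U \<subseteq> set (cols A)" "lin_indpt U"
    by (auto simp: maximal_def)
  have card: "card U = n"
    using rank_card_indpt[OF A max] rank by simp
  have "finite U"
    using U(1) finite_subset by blast
  then obtain us where us: "set us = U" "distinct us"
    using finite_distinct_list by blast
  have len: "length us = n"
    using us card distinct_card by metis
  have car: "set us \<subseteq> carrier_vec n"
    using us U(1) cols_dim[of A] A by auto
  define M where "M = mat_of_cols n us"
  have M: "M \<in> carrier_mat n n"
    using len by (auto simp: M_def)
  have colsM: "cols M = us"
    unfolding M_def using car by (rule cols_mat_of_cols)
  have "rank M = n"
    using lin_indpt_full_rank[OF M] colsM us U(2) by simp
  then have "det M \<noteq> 0"
    using det_rank_iff[OF M] by simp
  then have "det M\<^sup>T \<noteq> 0"
    using det_transpose[OF M] by simp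
  moreover have "M\<^sup>T *\<^sub>v v = 0\<^sub>v n"
  proof (rule eq_vecI)
    fix i assume "i < dim_vec (0\<^sub>v n :: real vec)"
    then have i: "i < n" by simp
    have "us ! i \<in> set (cols A)"
      using i len us U(1) by auto
    then obtain j where j: "j < k" "us ! i = col A j"
      using A by (auto simp: cols_def)
    have "col M i = us ! i"
      using i M colsM by (metis carrier_matD(2) cols_nth)
    then show "(M\<^sup>T *\<^sub>v v) $ i = 0\<^sub>v n $ i"
      using i M j orth by simp
  qed (use M in simp)
  ultimately show ?thesis
    using det_0_iff_vec_prod_zero_field[of "M\<^sup>T" n] v M by (metis transpose_carrier_mat)
qed

text \<open>
  Identities between composite matrices are proved below by comparing bilinear forms: there the
  noncommutative identity becomes linear arithmetic over the reals. The following rules push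
  a bilinear form to the leaves of a matrix expression. Their side conditions speak of dimensions
  and not of carrier sets, so that rewriting need not guess the inner dimensions of a product.
\<close>

lemma mult_mat_vec_assoc_dim:
  fixes M N :: "real mat"
  assumes "dim_col M = dim_row N" "dim_vec v = dim_col N"
  shows "(M * N) *\<^sub>v v = M *\<^sub>v (N *\<^sub>v v)"
  by (rule assoc_mult_mat_vec[OF carrier_matI carrier_matI carrier_vecI])
    (use assms in simp_all)

lemma scalar_prod_transpose_dim:
  fixes M :: "real mat"
  assumes "dim_vec x = dim_col M" "dim_vec y = dim_row M"
  shows "x \<bullet> (M\<^sup>T *\<^sub>v y) = (M *\<^sub>v x) \<bullet> y"
proof -
  have "x \<bullet> (M\<^sup>T *\<^sub>v y) = (M\<^sup>T *\<^sub>v y) \<bullet> x"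
    by (rule comm_scalar_prod[OF carrier_vecI carrier_vecI]) (use assms in simp_all)
  also have "\<dots> = y \<bullet> (M *\<^sub>v x)"
    by (rule transpose_vec_mult_scalar[OF carrier_matI carrier_vecI carrier_vecI])
      (use assms in simp_all)
  also have "\<dots> = (M *\<^sub>v x) \<bullet> y"
    by (rule comm_scalar_prod[OF carrier_vecI carrier_vecI]) (use assms in simp_all)
  finally show ?thesis .
qed

lemma add_mat_mult_vec_dim:
  fixes M N :: "real mat"
  assumes "dim_row M = dim_row N" "dim_col M = dim_col N" "dim_vec v = dim_col N"
  shows "(M + N) *\<^sub>v v = M *\<^sub>v v + N *\<^sub>v v"
  by (rule add_mult_distrib_mat_vec[OF carrier_matI carrier_matI carrier_vecI])
    (use assms in simp_all)

lemma minus_mat_mult_vec_dim: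
  fixes M N :: "real mat"
  assumes "dim_row M = dim_row N" "dim_col M = dim_col N" "dim_vec v = dim_col N"
  shows "(M - N) *\<^sub>v v = M *\<^sub>v v - N *\<^sub>v v"
  by (rule minus_mult_distrib_mat_vec[OF carrier_matI carrier_matI carrier_vecI])
    (use assms in simp_all)

lemma mult_mat_minus_vec_dim:
  fixes M :: "real mat"
  assumes "dim_vec u = dim_col M" "dim_vec v = dim_col M"
  shows "M *\<^sub>v (u - v) = M *\<^sub>v u - M *\<^sub>v v"
  by (rule mult_minus_distrib_mat_vec[OF carrier_matI carrier_vecI carrier_vecI])
    (use assms in simp_all)

lemma scalar_prod_add_dim:
  fixes x :: "real vec"
  assumes "dim_vec u = dim_vec x" "dim_vec v = dim_vec x"
  shows "x \<bullet> (u + v) = x \<bullet> u + x \<bullet> v"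
  by (rule scalar_prod_add_distrib[OF carrier_vecI carrier_vecI carrier_vecI])
    (use assms in simp_all)

lemma scalar_prod_minus_dim:
  fixes x :: "real vec"
  assumes "dim_vec u = dim_vec x" "dim_vec v = dim_vec x"
  shows "x \<bullet> (u - v) = x \<bullet> u - x \<bullet> v"
  by (rule scalar_prod_minus_distrib[OF carrier_vecI carrier_vecI carrier_vecI])
    (use assms in simp_all)

lemma minus_scalar_prod_dim:
  fixes x :: "real vec"
  assumes "dim_vec u = dim_vec x" "dim_vec v = dim_vec x"
  shows "(u - v) \<bullet> x = u \<bullet> x - v \<bullet> x"
  by (rule minus_scalar_prod_distrib[OF carrier_vecI carrier_vecI carrier_vecI])
    (use assms in simp_all)

lemmas bilinear_simps =
  mult_mat_vec_assoc_dim scalar_prod_transpose_dim add_mat_mult_vec_dim minus_mat_mult_vec_dim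
  mult_mat_minus_vec_dim scalar_prod_add_dim scalar_prod_minus_dim minus_scalar_prod_dim

lemma mat_eq_bilinearI:
  fixes M N :: "real mat"
  assumes M: "M \<in> carrier_mat r c" and N: "N \<in> carrier_mat r c"
    and eq: "\<And>x y. x \<in> carrier_vec r \<Longrightarrow> y \<in> carrier_vec c \<Longrightarrow> x \<bullet> (M *\<^sub>v y) = x \<bullet> (N *\<^sub>v y)"
  shows "M = N"
proof (rule eq_matI)
  fix i j assume "i < dim_row N" "j < dim_col N"
  then have i: "i < r" and j: "j < c" using N by auto
  have "K $$ (i, j) = unit_vec r i \<bullet> (K *\<^sub>v unit_vec c j)" if "K \<in> carrier_mat r c" for K :: "real mat"
    using that i j by simp
  then show "M $$ (i, j) = N $$ (i, j)"
    using M N eq[of "unit_vec r i" "unit_vec c j"] by simp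
qed (use M N in auto)

lemma minus_mat_eq_0D:
  fixes M N :: "real mat"
  assumes M: "M \<in> carrier_mat r c" and N: "N \<in> carrier_mat r c" and eq: "M - N = 0\<^sub>m r c"
  shows "M = N"
proof (rule eq_matI)
  fix i j assume ij: "i < dim_row N" "j < dim_col N"
  then have "(M - N) $$ (i, j) = 0"
    unfolding eq using N by simp
  then show "M $$ (i, j) = N $$ (i, j)" using ij by simp
qed (use M N in auto)

lemma symmetric_bilinear:
  fixes P :: "real mat"
  assumes "P \<in> carrier_mat k k" "P\<^sup>T = P" "x \<in> carrier_vec k" "y \<in> carrier_vec k"
  shows "x \<bullet> (P *\<^sub>v y) = y \<bullet> (P *\<^sub>v x)"
proof -
  have "x \<bullet> (P *\<^sub>v y) = x \<bullet> (P\<^sup>T *\<^sub>v y)"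
    using assms by simp
  also have "\<dots> = (P *\<^sub>v x) \<bullet> y"
    using assms by (intro scalar_prod_transpose_dim) auto
  also have "\<dots> = y \<bullet> (P *\<^sub>v x)"
    using assms by (intro comm_scalar_prod[of _ k]) auto
  finally show ?thesis .
qed

lemma bilinear_sum:
  fixes P :: "real mat"
  assumes "P \<in> carrier_mat r c" "x \<in> carrier_vec r" "y \<in> carrier_vec c"
  shows "x \<bullet> (P *\<^sub>v y) = (\<Sum>i<r. \<Sum>j<c. x $ i * P $$ (i, j) * y $ j)"
  using assms
  by (auto simp: scalar_prod_def sum_distrib_left lessThan_atLeast0 mult.assoc intro!: sum.cong)

lemma transpose_triple:
  fixes M N :: "real mat"
  assumes "N \<in> carrier_mat k k" "N\<^sup>T = N" "M \<in> carrier_mat k l"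
  shows "(M\<^sup>T * N * M)\<^sup>T = M\<^sup>T * N * M"
proof -
  have "(M\<^sup>T * N * M)\<^sup>T = M\<^sup>T * (M\<^sup>T * N)\<^sup>T"
    using assms by (intro transpose_mult[of _ l k _ l]) auto
  also have "(M\<^sup>T * N)\<^sup>T = N\<^sup>T * M"
    using assms transpose_mult[of "M\<^sup>T" l k N k] by simp
  also have "M\<^sup>T * (N\<^sup>T * M) = M\<^sup>T * N * M"
    using assms assoc_mult_mat[of "M\<^sup>T" l k N k M l] by simp
  finally show ?thesis .
qed

lemma bilinear_triple:
  fixes M N :: "real mat"
  assumes "N \<in> carrier_mat k k" "M \<in> carrier_mat k l" "x \<in> carrier_vec l" "y \<in> carrier_vec l"
  shows "x \<bullet> ((M\<^sup>T * N * M) *\<^sub>v y) = (M *\<^sub>v x) \<bullet> (N *\<^sub>v (M *\<^sub>v y))"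
  using assms by (simp add: bilinear_simps del: assoc_mult_mat)

lemma pos_semidef_triple:
  assumes "pos_semidef k N" "M \<in> carrier_mat k l"
  shows "pos_semidef l (M\<^sup>T * N * M)"
  using assms transpose_triple[of N k M l] bilinear_triple[of N k M l]
  by (auto simp: pos_semidef_def)

lemma pos_semidef_add:
  assumes "pos_semidef k M" "pos_semidef k N"
  shows "pos_semidef k (M + N)"
  using assms by (auto simp: pos_semidef_def transpose_add bilinear_simps)

lemma pos_def_imp_pos_semidef: "pos_def k M \<Longrightarrow> pos_semidef k M"
  unfolding pos_def_def pos_semidef_def
  by (metis less_eq_real_def mult_mat_vec_carrier scalar_prod_left_zero)

lemma pos_def_add_pos_semidef:
  assumes "pos_def k M" "pos_semidef k N"
  shows "pos_def k (M + N)"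
  using assms unfolding pos_semidef_def pos_def_def 
  by (auto simp: transpose_add bilinear_simps intro!: add_pos_nonneg)

section \<open>Schur stability and the Lyapunov equation\<close>

text \<open>
  Rescaling is what turns the uniform bound on the powers of a matrix of spectral radius below 1
  into geometric decay.
\<close>

lemma spectrum_smult_mem:
  fixes A :: "complex mat"
  assumes A: "A \<in> carrier_mat n n" and c: "c \<noteq> 0" and \<mu>: "\<mu> \<in> spectrum (c \<cdot>\<^sub>m A)"
  shows "\<mu> / c \<in> spectrum A"
proof -
  obtain v where v: "v \<in> carrier_vec n" "v \<noteq> 0\<^sub>v n" "(c \<cdot>\<^sub>m A) *\<^sub>v v = \<mu> \<cdot>\<^sub>v v"
    using \<mu> A by (auto simp: spectrum_def eigenvalue_def eigenvector_def)
  have cA: "(c \<cdot>\<^sub>m A) *\<^sub>v v = c \<cdot>\<^sub>v (A *\<^sub>v v)"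
    using A v(1) by (intro eq_vecI) auto
  have "A *\<^sub>v v = (1 / c) \<cdot>\<^sub>v (c \<cdot>\<^sub>v (A *\<^sub>v v))"
    using c by (simp add: smult_smult_assoc)
  also have "\<dots> = (1 / c) \<cdot>\<^sub>v (\<mu> \<cdot>\<^sub>v v)"
    using v(3) cA by simp
  finally have "A *\<^sub>v v = (\<mu> / c) \<cdot>\<^sub>v v"
    by (simp add: smult_smult_assoc)
  then show ?thesis
    using A v by (auto simp: spectrum_def eigenvalue_def eigenvector_def)
qed

lemma smult_mat_pow:
  fixes A :: "'a :: comm_ring_1 mat"
  assumes A: "A \<in> carrier_mat n n"
  shows "(c \<cdot>\<^sub>m A) ^\<^sub>m k = c ^ k \<cdot>\<^sub>m (A ^\<^sub>m k)"
proof (induction k)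
  case 0
  then show ?case using A by auto
next
  case (Suc k)
  have Ak: "A ^\<^sub>m k \<in> carrier_mat n n" using A by simp
  have "(c \<cdot>\<^sub>m A) ^\<^sub>m Suc k = (c ^ k \<cdot>\<^sub>m (A ^\<^sub>m k)) * (c \<cdot>\<^sub>m A)"
    using Suc by simp
  also have "\<dots> = c ^ Suc k \<cdot>\<^sub>m (A ^\<^sub>m k * A)"
    using A Ak by (intro eq_matI) auto
  finally show ?case by simp
qed

text \<open>
  For \<open>\<rho>(A) < r < 1\<close> the matrix \<open>A / r\<close> still has spectral radius below 1, so its powers are
  bounded by some \<open>c\<close>; hence those of \<open>A\<close> are bounded by \<open>c r\<^sup>k\<close>.
\<close>

lemma spec_rad_less_1_power_bound:
  assumes A: "A \<in> carrier_mat n n" and n: "n > 0" and sr: "spec_rad A < 1"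
  obtains c r where "0 < r" "r < 1" "\<And>k. norm_bound (A ^\<^sub>m k) (c * r ^ k)"
proof -
  let ?A = "map_mat complex_of_real A"
  have cA: "?A \<in> carrier_mat n n" using A by simp
  define \<rho> where "\<rho> = spec_rad A"
  have mem: "\<rho> \<in> norm ` spectrum ?A"
    and max: "\<And>a. a \<in> norm ` spectrum ?A \<Longrightarrow> a \<le> \<rho>"
    unfolding \<rho>_def using spectral_radius_mem_max[OF cA n] by auto
  have "\<rho> \<ge> 0" using mem by auto
  define r where "r = (1 + \<rho>) / 2"
  have r: "0 < r" "r < 1" "\<rho> < r"
    using \<open>\<rho> \<ge> 0\<close> sr by (auto simp: r_def \<rho>_def)
  let ?c = "complex_of_real (1 / r)"
  let ?B = "?c \<cdot>\<^sub>m ?A"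
  have B: "?B \<in> carrier_mat n n" using cA by simp
  have "spectral_radius ?B \<in> norm ` spectrum ?B"
    using spectral_radius_mem_max[OF B n] by auto
  then obtain \<mu> where \<mu>: "\<mu> \<in> spectrum ?B" "spectral_radius ?B = norm \<mu>"
    by auto
  have "\<mu> / ?c \<in> spectrum ?A"
    using spectrum_smult_mem[OF cA _ \<mu>(1)] r by simp
  then have "norm (\<mu> / ?c) \<le> \<rho>"
    using max by blast
  then have "norm \<mu> * r \<le> \<rho>"
    using r by (simp add: norm_mult norm_divide)
  then have "norm \<mu> < 1"
    using r by (smt (verit) mult_less_cancel_right2)
  then obtain c where c: "\<And>k. norm_bound (?B ^\<^sub>m k) c"
    using spectral_radius_jnf_norm_bound_less_1_upper_triangular[OF B] \<mu>(2) by auto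
  have "norm_bound (A ^\<^sub>m k) (c * r ^ k)" for k
  proof (rule norm_boundI)
    fix i j assume "i < dim_row (A ^\<^sub>m k)" "j < dim_col (A ^\<^sub>m k)"
    moreover have Ak: "A ^\<^sub>m k \<in> carrier_mat n n" using A by simp
    ultimately have ij: "i < n" "j < n" by auto
    have "?B ^\<^sub>m k = ?c ^ k \<cdot>\<^sub>m (map_mat complex_of_real (A ^\<^sub>m k))"
      using smult_mat_pow[OF cA] of_real_hom.mat_hom_pow[OF A] by metis
    moreover have "(b \<cdot>\<^sub>m map_mat complex_of_real D) $$ (i, j) = b * complex_of_real (D $$ (i, j))"
      if "D \<in> carrier_mat n n" for b D
      using that ij by simp
    ultimately have "(?B ^\<^sub>m k) $$ (i, j) = ?c ^ k * complex_of_real ((A ^\<^sub>m k) $$ (i, j))"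
      using Ak by metis
    moreover have "norm ((?B ^\<^sub>m k) $$ (i, j)) \<le> c"
      using c[of k, unfolded norm_bound_def] ij carrier_matD[OF pow_carrier_mat[OF B, of k]] by metis
    ultimately have "(1 / r) ^ k * \<bar>(A ^\<^sub>m k) $$ (i, j)\<bar> \<le> c"
      using r by (simp add: norm_mult norm_power norm_divide)
    then show "norm ((A ^\<^sub>m k) $$ (i, j)) \<le> c * r ^ k"
      using r by (simp add: field_simps)
  qed
  then show ?thesis using that r by blast
qed

lemma stable_conjugate_bound:
  assumes A: "A \<in> carrier_mat n n" and n: "n > 0" and sr: "spec_rad A < 1"
    and W: "W \<in> carrier_mat n n"
  obtains c s where "0 < s" "s < 1" "\<And>k. norm_bound ((A ^\<^sub>m k)\<^sup>T * W * A ^\<^sub>m k) (c * s ^ k)"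
proof -
  obtain c r where r: "0 < r" "r < 1" and b: "\<And>k. norm_bound (A ^\<^sub>m k) (c * r ^ k)"
    by (rule spec_rad_less_1_power_bound[OF A n sr]) (rule that)
  obtain w where w: "norm_bound W w"
    using norm_bound_max by blast
  have "norm_bound ((A ^\<^sub>m k)\<^sup>T * W * A ^\<^sub>m k) ((c * w * real n * c * real n) * (r * r) ^ k)" for k
  proof -
    have Ak: "A ^\<^sub>m k \<in> carrier_mat n n" "(A ^\<^sub>m k)\<^sup>T \<in> carrier_mat n n" using A by auto
    have bT: "norm_bound ((A ^\<^sub>m k)\<^sup>T) (c * r ^ k)"
      using b[of k] by (auto simp: norm_bound_def)
    have "norm_bound ((A ^\<^sub>m k)\<^sup>T * W * A ^\<^sub>m k) (((c * r ^ k) * w * of_nat n) * (c * r ^ k) * of_nat n)"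
      using norm_bound_mult[OF mult_carrier_mat[OF Ak(2) W] Ak(1) norm_bound_mult[OF Ak(2) W bT w] b] .
    then show ?thesis
      by (simp add: power_mult_distrib mult_ac)
  qed
  moreover have "0 < r * r" "r * r < 1"
    using r mult_strict_mono[of r 1 r 1] by auto
  ultimately show ?thesis using that by blast
qed

lemma conjugate_pow_Suc:
  fixes A W :: "real mat"
  assumes A: "A \<in> carrier_mat n n" and W: "W \<in> carrier_mat n n"
  shows "(A ^\<^sub>m Suc k)\<^sup>T * W * A ^\<^sub>m Suc k = A\<^sup>T * ((A ^\<^sub>m k)\<^sup>T * W * A ^\<^sub>m k) * A"
  by (rule mat_eq_bilinearI[of _ n n])
    (use A W in \<open>auto simp: bilinear_simps simp del: assoc_mult_mat\<close>)

text \<open>Iterating a solution \<open>E = A\<^sup>T E A\<close> of the homogeneous equation gives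
  \<open>E = (A\<^sup>k)\<^sup>T E A\<^sup>k\<close> for all \<open>k\<close>, and the right-hand side tends to zero.\<close>

lemma stable_homogeneous_lyapunov:
  assumes A: "A \<in> carrier_mat n n" and n: "n > 0" and sr: "spec_rad A < 1"
    and E: "E \<in> carrier_mat n n" and fix_E: "E = A\<^sup>T * E * A"
  shows "E = 0\<^sub>m n n"
proof -
  obtain c s where s: "0 < s" "s < 1"
    and b: "\<And>k. norm_bound ((A ^\<^sub>m k)\<^sup>T * E * A ^\<^sub>m k) (c * s ^ k)"
    by (rule stable_conjugate_bound[OF A n sr E]) (rule that)
  have iter: "(A ^\<^sub>m k)\<^sup>T * E * A ^\<^sub>m k = E" for k
  proof (induction k)
    case 0
    then show ?case using A E by simp
  next
    case (Suc k)
    then show ?case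
      using conjugate_pow_Suc[OF A E, of k] fix_E by simp
  qed
  have lim: "(\<lambda>k. c * s ^ k) \<longlonglongrightarrow> 0"
    using s by (intro tendsto_mult_right_zero LIMSEQ_power_zero) auto
  show ?thesis
  proof (rule eq_matI)
    fix i j assume "i < dim_row (0\<^sub>m n n :: real mat)" "j < dim_col (0\<^sub>m n n :: real mat)"
    then have ij: "i < n" "j < n" by auto
    have "norm (E $$ (i, j)) \<le> c * s ^ k" for k
      using b[of k] ij E by (simp add: iter norm_bound_def)
    then have "norm (E $$ (i, j)) \<le> 0"
      using LIMSEQ_le_const[OF lim] by blast
    then show "E $$ (i, j) = 0\<^sub>m n n $$ (i, j)"
      using ij by simp
  qed (use E in auto)
qed

lemma lyapunov_unique:
  assumes A: "A \<in> carrier_mat n n" and n: "n > 0" and sr: "spec_rad A < 1"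
    and W: "W \<in> carrier_mat n n" and P: "P \<in> carrier_mat n n" and P': "P' \<in> carrier_mat n n"
    and eq: "P = W + A\<^sup>T * P * A" and eq': "P' = W + A\<^sup>T * P' * A"
  shows "P = P'"
proof -
  have "P - P' = A\<^sup>T * (P - P') * A"
  proof (rule mat_eq_bilinearI[of _ n n])
    fix x y :: "real vec" assume xy: "x \<in> carrier_vec n" "y \<in> carrier_vec n"
    have "x \<bullet> (P *\<^sub>v y) = x \<bullet> (W *\<^sub>v y) + (A *\<^sub>v x) \<bullet> (P *\<^sub>v (A *\<^sub>v y))"
      using A W P xy by (subst eq) (simp add: bilinear_simps del: assoc_mult_mat)
    moreover have "x \<bullet> (P' *\<^sub>v y) = x \<bullet> (W *\<^sub>v y) + (A *\<^sub>v x) \<bullet> (P' *\<^sub>v (A *\<^sub>v y))"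
      using A W P' xy by (subst eq') (simp add: bilinear_simps del: assoc_mult_mat)
    ultimately show "x \<bullet> ((P - P') *\<^sub>v y) = x \<bullet> (A\<^sup>T * (P - P') * A *\<^sub>v y)"
      using A P P' xy by (simp add: bilinear_simps del: assoc_mult_mat)
  qed (use A P P' in auto)
  then have "P - P' = 0\<^sub>m n n"
    using stable_homogeneous_lyapunov[OF A n sr minus_carrier_mat[OF P']] by blast
  then show ?thesis
    by (rule minus_mat_eq_0D[OF P P'])
qed

text \<open>
  The solution is the series \<open>P = \<Sum>\<^sub>k (A\<^sup>k)\<^sup>T W A\<^sup>k\<close>, which converges entrywise by the geometric
  bound. Shifting its index gives the equation, and every summand is positive semidefinite.
\<close>

lemma lyapunov_exists:
  assumes A: "A \<in> carrier_mat n n" and n: "n > 0" and sr: "spec_rad A < 1"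
    and W: "pos_semidef n W"
  obtains P where "pos_semidef n P" "P = W + A\<^sup>T * P * A"
proof -
  have Wc: "W \<in> carrier_mat n n" and Wt: "W\<^sup>T = W"
    using W by (auto simp: pos_semidef_def)
  define X where "X k = (A ^\<^sub>m k)\<^sup>T * W * A ^\<^sub>m k" for k
  have Ak: "A ^\<^sub>m k \<in> carrier_mat n n" for k
    using A by simp
  have Xpsd: "pos_semidef n (X k)" for k
    unfolding X_def using W Ak by (rule pos_semidef_triple)
  then have Xc: "X k \<in> carrier_mat n n" for k
    by (simp add: pos_semidef_def)
  define P where "P = mat n n (\<lambda>(i, j). \<Sum>k. X k $$ (i, j))"
  have Pc: "P \<in> carrier_mat n n" by (simp add: P_def)
  obtain c s where s: "0 < s" "s < 1" and b: "\<And>k. norm_bound (X k) (c * s ^ k)"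
    by (rule stable_conjugate_bound[OF A n sr Wc, folded X_def]) (rule that)
  have entry: "(\<lambda>k. X k $$ (i, j)) sums (P $$ (i, j))" if "i < n" "j < n" for i j
  proof -
    have "summable (\<lambda>k. c * s ^ k)"
      using s by (intro summable_mult summable_geometric) auto
    moreover have "norm (X k $$ (i, j)) \<le> c * s ^ k" for k
      using b[of k, unfolded norm_bound_def] that unfolding carrier_matD[OF Xc[of k]] by blast
    ultimately have "summable (\<lambda>k. X k $$ (i, j))"
      by (rule summable_comparison_test'[of _ 0])
    then show ?thesis
      using that by (simp add: P_def summable_sums)
  qed
  have bil: "(\<lambda>k. x \<bullet> (X k *\<^sub>v y)) sums (x \<bullet> (P *\<^sub>v y))"
    if "x \<in> carrier_vec n" "y \<in> carrier_vec n" for x y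
    unfolding bilinear_sum[OF Xc that] bilinear_sum[OF Pc that]
    by (intro sums_sum sums_mult sums_mult2 entry) auto
  have "P\<^sup>T = P"
  proof (rule eq_matI)
    fix i j assume "i < dim_row P" "j < dim_col P"
    then have ij: "i < n" "j < n" using Pc by auto
    have "X k $$ (j, i) = X k $$ (i, j)" for k
    proof -
      have "(X k)\<^sup>T = X k"
        using Xpsd by (simp add: pos_semidef_def)
      moreover have "(X k)\<^sup>T $$ (i, j) = X k $$ (j, i)"
        using Xc[of k] ij by (intro index_transpose_mat) auto
      ultimately show ?thesis by simp
    qed
    then show "P\<^sup>T $$ (i, j) = P $$ (i, j)"
      using ij by (simp add: P_def)
  qed (use Pc in auto)
  moreover have "x \<bullet> (P *\<^sub>v x) \<ge> 0" if "x \<in> carrier_vec n" for x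
    using Xpsd that by (intro sums_le[OF _ sums_zero bil[OF that that]]) (auto simp: pos_semidef_def)
  ultimately have psd: "pos_semidef n P"
    using Pc by (simp add: pos_semidef_def)
  have "P = W + A\<^sup>T * P * A"
  proof (rule mat_eq_bilinearI[of _ n n])
    fix x y :: "real vec" assume xy: "x \<in> carrier_vec n" "y \<in> carrier_vec n"
    have Axy: "A *\<^sub>v x \<in> carrier_vec n" "A *\<^sub>v y \<in> carrier_vec n"
      using A xy by auto
    have X0: "X 0 = W"
      using A Wc by (simp add: X_def)
    have "X (Suc k) = A\<^sup>T * X k * A" for k
      unfolding X_def by (rule conjugate_pow_Suc[OF A Wc])
    then have "x \<bullet> (X (Suc k) *\<^sub>v y) = (A *\<^sub>v x) \<bullet> (X k *\<^sub>v (A *\<^sub>v y))" for k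
      using bilinear_triple[OF Xc A xy] by metis
    then have "(\<lambda>k. x \<bullet> (X (Suc k) *\<^sub>v y)) sums ((A *\<^sub>v x) \<bullet> (P *\<^sub>v (A *\<^sub>v y)))"
      using bil[OF Axy] by simp
    then have "(\<lambda>k. x \<bullet> (X k *\<^sub>v y)) sums ((A *\<^sub>v x) \<bullet> (P *\<^sub>v (A *\<^sub>v y)) + x \<bullet> (W *\<^sub>v y))"
      by (subst (asm) sums_Suc_iff) (simp add: X0)
    then have "x \<bullet> (P *\<^sub>v y) = (A *\<^sub>v x) \<bullet> (P *\<^sub>v (A *\<^sub>v y)) + x \<bullet> (W *\<^sub>v y)"
      using bil[OF xy] sums_unique2 by blast
    then show "x \<bullet> (P *\<^sub>v y) = x \<bullet> ((W + A\<^sup>T * P * A) *\<^sub>v y)"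
      using A Pc Wc xy by (simp add: bilinear_simps del: assoc_mult_mat)
  qed (use A Pc Wc in auto)
  then show ?thesis using that psd by blast
qed

section \<open>Traces against a covariance matrix\<close>

lemma centered_random_vec_integrable:
  assumes cv: "centered_random_vec n M x" and ij: "i < n" "j < n"
  shows "integrable M (\<lambda>\<omega>. x \<omega> $ i * x \<omega> $ j)"
proof (rule Bochner_Integration.integrable_bound)
  show "integrable M (\<lambda>\<omega>. (x \<omega> $ i)\<^sup>2 + (x \<omega> $ j)\<^sup>2)"
    using cv ij by (simp add: centered_random_vec_def)
  show "(\<lambda>\<omega>. x \<omega> $ i * x \<omega> $ j) \<in> borel_measurable M"
    using cv ij unfolding centered_random_vec_def by (intro borel_measurable_times) blast+
  have "\<bar>a * b\<bar> \<le> a\<^sup>2 + b\<^sup>2" for a b :: real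
  proof -
    have "0 \<le> (\<bar>a\<bar> - \<bar>b\<bar>)\<^sup>2" by simp
    then have "2 * \<bar>a * b\<bar> \<le> a\<^sup>2 + b\<^sup>2"
      by (simp add: power2_diff abs_mult)
    then show ?thesis by simp
  qed
  then show "AE \<omega> in M. norm (x \<omega> $ i * x \<omega> $ j) \<le> norm ((x \<omega> $ i)\<^sup>2 + (x \<omega> $ j)\<^sup>2)"
    by simp
qed

lemma trace_covariance:
  assumes cv: "centered_random_vec n M x" and P: "P \<in> carrier_mat n n"
  shows "integrable M (\<lambda>\<omega>. x \<omega> \<bullet> (P *\<^sub>v x \<omega>))"
    and "tr (P * covariance_mat n M x) = (\<integral>\<omega>. x \<omega> \<bullet> (P *\<^sub>v x \<omega>) \<partial>M)"
proof -
  define f where "f \<omega> = (\<Sum>i<n. \<Sum>j<n. P $$ (i, j) * (x \<omega> $ j * x \<omega> $ i))" for \<omega>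
  have f: "x \<omega> \<bullet> (P *\<^sub>v x \<omega>) = f \<omega>" if "\<omega> \<in> space M" for \<omega>
  proof -
    have "x \<omega> \<in> carrier_vec n"
      using cv that by (simp add: centered_random_vec_def)
    from bilinear_sum[OF P this this] show ?thesis
      by (simp add: f_def mult_ac)
  qed
  have int: "integrable M (\<lambda>\<omega>. P $$ (i, j) * (x \<omega> $ j * x \<omega> $ i))" if "i < n" "j < n" for i j
    using centered_random_vec_integrable[OF cv that(2,1)] by simp
  have "integrable M f"
    unfolding f_def by (intro Bochner_Integration.integrable_sum int) auto
  then show "integrable M (\<lambda>\<omega>. x \<omega> \<bullet> (P *\<^sub>v x \<omega>))"
    using f by (subst Bochner_Integration.integrable_cong[OF refl, of _ _ f]) auto
  have "tr (P * covariance_mat n M x)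
      = (\<Sum>i<n. \<Sum>j<n. P $$ (i, j) * (\<integral>\<omega>. x \<omega> $ j * x \<omega> $ i \<partial>M))"
    using P by (simp add: tr_def covariance_mat_def scalar_prod_def lessThan_atLeast0)
  also have "\<dots> = (\<Sum>i<n. \<Sum>j<n. (\<integral>\<omega>. P $$ (i, j) * (x \<omega> $ j * x \<omega> $ i) \<partial>M))"
    by simp
  also have "\<dots> = (\<Sum>i<n. (\<integral>\<omega>. (\<Sum>j<n. P $$ (i, j) * (x \<omega> $ j * x \<omega> $ i)) \<partial>M))"
    by (intro sum.cong refl Bochner_Integration.integral_sum[symmetric] int) auto
  also have "\<dots> = (\<integral>\<omega>. f \<omega> \<partial>M)"
    unfolding f_def
    by (intro Bochner_Integration.integral_sum[symmetric] Bochner_Integration.integrable_sum int) auto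
  also have "\<dots> = (\<integral>\<omega>. x \<omega> \<bullet> (P *\<^sub>v x \<omega>) \<partial>M)"
    using f by (intro Bochner_Integration.integral_cong) auto
  finally show "tr (P * covariance_mat n M x) = (\<integral>\<omega>. x \<omega> \<bullet> (P *\<^sub>v x \<omega>) \<partial>M)" .
qed

text \<open>
  Writing the trace as an expectation makes positivity evident, without a square root of either
  factor.
\<close>

lemma trace_covariance_nonneg:
  assumes cv: "centered_random_vec n M x" and P: "pos_semidef n P"
  shows "tr (P * covariance_mat n M x) \<ge> 0"
proof -
  have "P \<in> carrier_mat n n" "\<And>v. v \<in> carrier_vec n \<Longrightarrow> v \<bullet> (P *\<^sub>v v) \<ge> 0"
    using P by (auto simp: pos_semidef_def)
  then show ?thesis
    using cv trace_covariance(2)[OF cv]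
    by (auto simp: centered_random_vec_def intro!: Bochner_Integration.integral_nonneg)
qed

text \<open>
  The trace is the expectation of \<open>(E x)\<^sup>T G (E x) \<ge> 0\<close>. If it vanishes, then \<open>E x = 0\<close> almost
  surely, since \<open>G\<close> is positive definite. So each row \<open>e\<close> of \<open>E\<close> satisfies \<open>e \<bullet> x = 0\<close> almost
  surely, whence \<open>e\<^sup>T \<Sigma> e = 0\<close> for the covariance \<open>\<Sigma>\<close>, and \<open>e = 0\<close>.
\<close>

lemma trace_covariance_eq_0:
  assumes cv: "centered_random_vec n M x" and pd: "pos_def n (covariance_mat n M x)"
    and G: "pos_def m G" and E: "E \<in> carrier_mat m n"
    and tr0: "tr (E\<^sup>T * G * E * covariance_mat n M x) = 0"
  shows "E = 0\<^sub>m m n"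
proof -
  let ?\<Sigma> = "covariance_mat n M x"
  have Gc: "G \<in> carrier_mat m m" using G by (simp add: pos_def_def)
  have Gnn: "v \<bullet> (G *\<^sub>v v) \<ge> 0" if "v \<in> carrier_vec m" for v
    using pos_def_imp_pos_semidef[OF G] that by (simp add: pos_semidef_def)
  have W: "E\<^sup>T * G * E \<in> carrier_mat n n" using E Gc by simp
  have xc: "x \<omega> \<in> carrier_vec n" if "\<omega> \<in> space M" for \<omega>
    using cv that by (simp add: centered_random_vec_def)
  have q: "x \<omega> \<bullet> ((E\<^sup>T * G * E) *\<^sub>v x \<omega>) = (E *\<^sub>v x \<omega>) \<bullet> (G *\<^sub>v (E *\<^sub>v x \<omega>))"
    if "\<omega> \<in> space M" for \<omega>
    using bilinear_triple[OF Gc E xc[OF that] xc[OF that]] .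
  have "(\<integral>\<omega>. x \<omega> \<bullet> ((E\<^sup>T * G * E) *\<^sub>v x \<omega>) \<partial>M) = 0"
    using trace_covariance(2)[OF cv W] tr0 by simp
  moreover have "AE \<omega> in M. 0 \<le> x \<omega> \<bullet> ((E\<^sup>T * G * E) *\<^sub>v x \<omega>)"
  proof (rule AE_I2)
    fix \<omega> assume \<omega>: "\<omega> \<in> space M"
    show "0 \<le> x \<omega> \<bullet> ((E\<^sup>T * G * E) *\<^sub>v x \<omega>)"
      unfolding q[OF \<omega>] by (rule Gnn) (use E xc[OF \<omega>] in simp)
  qed
  ultimately have "AE \<omega> in M. x \<omega> \<bullet> ((E\<^sup>T * G * E) *\<^sub>v x \<omega>) = 0"
    using integral_nonneg_eq_0_iff_AE[OF trace_covariance(1)[OF cv W]] by blast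
  moreover have "E *\<^sub>v x \<omega> = 0\<^sub>v m"
    if \<omega>: "\<omega> \<in> space M" and 0: "x \<omega> \<bullet> ((E\<^sup>T * G * E) *\<^sub>v x \<omega>) = 0" for \<omega>
  proof (rule ccontr)
    assume "E *\<^sub>v x \<omega> \<noteq> 0\<^sub>v m"
    moreover have "E *\<^sub>v x \<omega> \<in> carrier_vec m" using E xc[OF \<omega>] by simp
    ultimately show False
      using G 0 unfolding q[OF \<omega>] pos_def_def by fastforce
  qed
  ultimately have AE0: "AE \<omega> in M. E *\<^sub>v x \<omega> = 0\<^sub>v m"
    by (elim AE_mp) (auto intro!: AE_I2)
  have "row E i = 0\<^sub>v n" if i: "i < m" for i
  proof (rule ccontr)
    let ?e = "row E i"
    \<comment> \<open>The rank-one matrix \<open>N = e e\<^sup>T\<close> links both sides: \<open>e\<^sup>T \<Sigma> e = Tr (N \<Sigma>)\<close> and \<open>x\<^sup>T N x = (e \<bullet> x)\<^sup>2\<close>.\<close>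
    let ?N = "mat n n (\<lambda>(j, k). ?e $ j * ?e $ k)"
    assume "?e \<noteq> 0\<^sub>v n"
    moreover have e: "?e \<in> carrier_vec n" using E i by simp
    ultimately have pos: "?e \<bullet> (?\<Sigma> *\<^sub>v ?e) > 0"
      using pd by (simp add: pos_def_def)
    have \<Sigma>c: "?\<Sigma> \<in> carrier_mat n n"
      by (simp add: covariance_mat_def)
    have N: "?N \<in> carrier_mat n n" by simp
    have "?e \<bullet> (?\<Sigma> *\<^sub>v ?e) = tr (?N * ?\<Sigma>)"
      unfolding bilinear_sum[OF \<Sigma>c e e]
      by (subst sum.swap)
        (simp add: tr_def covariance_mat_def scalar_prod_def lessThan_atLeast0 mult_ac)
    moreover have "tr (?N * ?\<Sigma>) = (\<integral>\<omega>. x \<omega> \<bullet> (?N *\<^sub>v x \<omega>) \<partial>M)"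
      using trace_covariance(2)[OF cv N] .
    moreover have "(\<integral>\<omega>. x \<omega> \<bullet> (?N *\<^sub>v x \<omega>) \<partial>M) = 0"
    proof (rule integral_eq_zero_AE)
      have "x \<omega> \<bullet> (?N *\<^sub>v x \<omega>) = (?e \<bullet> x \<omega>)\<^sup>2" if \<omega>: "\<omega> \<in> space M" for \<omega>
        unfolding bilinear_sum[OF N xc[OF \<omega>] xc[OF \<omega>]]
        using xc[OF \<omega>]
        by (simp add: scalar_prod_def power2_eq_square sum_product lessThan_atLeast0 mult_ac)
      moreover have "?e \<bullet> x \<omega> = 0" if "E *\<^sub>v x \<omega> = 0\<^sub>v m" for \<omega>
      proof -
        have "(E *\<^sub>v x \<omega>) $ i = 0" unfolding that using i by simp
        then show ?thesis using E i by simp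
      qed
      ultimately show "AE \<omega> in M. x \<omega> \<bullet> (?N *\<^sub>v x \<omega>) = 0"
        using AE0 by (elim AE_mp) (auto intro!: AE_I2)
    qed
    ultimately show False using pos by simp
  qed
  then show ?thesis
    using E by (intro eq_rowI) auto
qed

section \<open>The input-output LQR problem\<close>

context io_lqr
begin

lemma S_carrier: "S \<in> carrier_mat n q"
  by (simp add: S_def)

lemma ctrb_mat_carrier: "ctrb_mat k \<in> carrier_mat n (k * m)"
  by (simp add: ctrb_mat_def)

text \<open>
  Since \<open>p\<close> is at least the controllability index, the columns of the controllability matrix that
  already has full row rank are among those considered here.
\<close>

lemma ctrb_left_kernel_trivial:
  assumes ctrb: "controllable" and v: "v \<in> carrier_vec n"
    and orth: "\<And>j. j < p * m \<Longrightarrow> col (ctrb_mat p) j \<bullet> v = 0"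
  shows "v = 0\<^sub>v n"
proof (rule full_row_rank_imp_left_kernel_trivial[OF ctrb_mat_carrier _ v])
  show "vec_space.rank n (ctrb_mat ctrb_index) = n"
    unfolding ctrb_index_def
    by (rule LeastI) (use ctrb in \<open>simp add: controllable_def\<close>)
  fix j assume j: "j < ctrb_index * m"
  have "ctrb_index * m \<le> p * m"
    by (rule mult_right_mono) (simp_all add: p_def)
  with j have j': "j < p * m" by (rule less_le_trans)
  have "col (ctrb_mat ctrb_index) j = col (ctrb_mat p) j"
    using j j' by (intro eq_vecI) (auto simp: ctrb_mat_def)
  then show "col (ctrb_mat ctrb_index) j \<bullet> v = 0"
    using orth[OF j'] by simp
qed

text \<open>
  Put \<open>X = A\<^sup>p \<O>\<^sup>\<dagger>\<close>, so that \<open>S = [\<C> - X \<T>, X]\<close>. If \<open>v\<^sup>T S = 0\<close>, the second block gives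
  \<open>v\<^sup>T X = 0\<close>; then the first block gives \<open>v\<^sup>T \<C> = 0\<close>.
\<close>

lemma S_left_kernel_trivial:
  assumes A: "A \<in> carrier_mat n n" and ctrb: "controllable" and v: "v \<in> carrier_vec n"
    and Sv: "S\<^sup>T *\<^sub>v v = 0\<^sub>v q"
  shows "v = 0\<^sub>v n"
proof (rule ctrb_left_kernel_trivial[OF ctrb v])
  define X where "X = A ^\<^sub>m p * obs_pinv"
  have X: "X \<in> carrier_mat n (p * d)"
    using A by (intro carrier_matI) (simp_all add: X_def obs_pinv_def obs_mat_def)
  have T: "toeplitz_mat \<in> carrier_mat (p * d) (p * m)"
    by (simp add: toeplitz_mat_def)
  have q: "q = p * m + p * d"
    by (simp add: q_def distrib_left)
  have colS: "col S j \<bullet> v = 0" if "j < q" for j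
  proof -
    have "(S\<^sup>T *\<^sub>v v) $ j = 0" unfolding Sv using that by simp
    then show ?thesis using S_carrier that by simp
  qed
  have X0: "X\<^sup>T *\<^sub>v v = 0\<^sub>v (p * d)"
  proof (rule eq_vecI)
    fix j assume "j < dim_vec (0\<^sub>v (p * d) :: real vec)"
    then have j: "j < p * d" by simp
    have "col X j = col S (p * m + j)"
      using X j q by (intro eq_vecI) (auto simp: S_def X_def[symmetric])
    then show "(X\<^sup>T *\<^sub>v v) $ j = 0\<^sub>v (p * d) $ j"
      using colS[of "p * m + j"] X j q by simp
  qed (use X in simp)
  have XT: "col (X * toeplitz_mat) j \<bullet> v = 0" if "j < p * m" for j
  proof -
    have c: "col toeplitz_mat j \<in> carrier_vec (p * d)" using T that by simp
    have "col (X * toeplitz_mat) j = X *\<^sub>v col toeplitz_mat j"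
      using X T that by (intro eq_vecI) auto
    then have "col (X * toeplitz_mat) j \<bullet> v = col toeplitz_mat j \<bullet> (X\<^sup>T *\<^sub>v v)"
      using scalar_prod_transpose_dim[of "col toeplitz_mat j" X v] X T v by simp
    then show ?thesis
      unfolding X0 using c by simp
  qed
  fix j assume j: "j < p * m"
  have "col S j = col (ctrb_mat p) j - col (X * toeplitz_mat) j"
    using X T j q by (intro eq_vecI) (auto simp: S_def X_def[symmetric] ctrb_mat_def)
  then have "col S j \<bullet> v = col (ctrb_mat p) j \<bullet> v - col (X * toeplitz_mat) j \<bullet> v"
    using minus_scalar_prod_dim[of "col (ctrb_mat p) j" v "col (X * toeplitz_mat) j"]
      X T v j by (simp add: ctrb_mat_def)
  then show "col (ctrb_mat p) j \<bullet> v = 0"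
    using colS[of j] XT[OF j] j q by simp
qed

lemma S_right_inverse:
  assumes A: "A \<in> carrier_mat n n" and ctrb: "controllable"
  shows "S_pinv \<in> carrier_mat q n" "S * S_pinv = 1\<^sub>m n"
proof -
  have ST: "S\<^sup>T \<in> carrier_mat q n" using S_carrier by simp
  have inj: "v = 0\<^sub>v n" if v: "v \<in> carrier_vec n" and 0: "(S * S\<^sup>T) *\<^sub>v v = 0\<^sub>v n" for v
  proof (rule S_left_kernel_trivial[OF A ctrb v])
    have "(S\<^sup>T *\<^sub>v v) \<bullet> (S\<^sup>T *\<^sub>v v) = v \<bullet> (S *\<^sub>v (S\<^sup>T *\<^sub>v v))"
      by (rule transpose_vec_mult_scalar[OF S_carrier _ v]) (use ST v in simp)
    also have "\<dots> = v \<bullet> ((S * S\<^sup>T) *\<^sub>v v)"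
      using S_carrier ST v by simp
    also have "\<dots> = 0"
      unfolding 0 using v by simp
    finally have "S\<^sup>T *\<^sub>v v = 0\<^sub>v (dim_vec (S\<^sup>T *\<^sub>v v))"
      by (rule scalar_prod_self_eq_0)
    then show "S\<^sup>T *\<^sub>v v = 0\<^sub>v q"
      using carrier_matD[OF S_carrier] by simp
  qed
  note I = minv_inverse[OF mult_carrier_mat[OF S_carrier ST] inj]
  show "S_pinv \<in> carrier_mat q n"
    unfolding S_pinv_def using ST I(1) by simp
  show "S * S_pinv = 1\<^sub>m n"
    unfolding S_pinv_def using I(2) assoc_mult_mat[OF S_carrier ST I(1)] by simp
qed

lemma Qc_pos_semidef:
  assumes "C \<in> carrier_mat d n" "pos_semidef d Q"
  shows "pos_semidef n Qc"
  unfolding Qc_def using assms pos_semidef_triple by blast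

lemma closed_loop_eq:
  assumes "B \<in> carrier_mat n m" "K \<in> carrier_mat m q" "S_pinv \<in> carrier_mat q n"
  shows "closed_loop K = A - B * (K * S_pinv)"
  using assms by (simp add: closed_loop_def assoc_mult_mat[of B n m K q S_pinv n])

text \<open>
  By uniqueness of the solution of a stable Lyapunov equation, the definite description in the
  definition of the cost matrix can be evaluated by exhibiting any positive semidefinite solution.
\<close>

lemma cost_mat_eqI:
  assumes n: "n > 0" and dims: "A \<in> carrier_mat n n" "B \<in> carrier_mat n m" "C \<in> carrier_mat d n"
    and Q: "pos_semidef d Q" and R: "pos_def m R"
    and Sp: "S_pinv \<in> carrier_mat q n" and K: "K \<in> feasible"
    and P: "pos_semidef n P"
    and eq: "P = Qc + (K * S_pinv)\<^sup>T * R * (K * S_pinv) + (closed_loop K)\<^sup>T * P * closed_loop K"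
  shows "cost_mat K = P"
proof -
  have Kc: "K \<in> carrier_mat m q" and sr: "spec_rad (closed_loop K) < 1"
    using K by (auto simp: feasible_def)
  have Rc: "R \<in> carrier_mat m m" using R by (simp add: pos_def_def)
  have Qcc: "Qc \<in> carrier_mat n n"
    using Qc_pos_semidef[OF dims(3) Q] by (simp add: pos_semidef_def)
  define L where "L = K * S_pinv"
  have L: "L \<in> carrier_mat m n" using Kc Sp by (simp add: L_def)
  have cl: "closed_loop K \<in> carrier_mat n n"
    unfolding closed_loop_eq[OF dims(2) Kc Sp] L_def[symmetric] using dims(2) L by auto
  have LT: "S_pinv\<^sup>T * K\<^sup>T = L\<^sup>T"
    unfolding L_def using transpose_mult[OF Kc Sp] by simp
  have "S_pinv\<^sup>T * K\<^sup>T * R * K * S_pinv = L\<^sup>T * R * L"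
    unfolding LT
    using assoc_mult_mat[OF mult_carrier_mat[OF transpose_carrier_mat[THEN iffD2, OF L] Rc] Kc Sp]
    by (simp only: L_def[symmetric])
  then have def: "cost_mat K = (THE P. pos_semidef n P \<and>
      P = (Qc + L\<^sup>T * R * L) + (closed_loop K)\<^sup>T * P * closed_loop K)"
    by (simp add: cost_mat_def)
  have W: "Qc + L\<^sup>T * R * L \<in> carrier_mat n n"
    using Qcc L Rc by simp
  show ?thesis
    unfolding def
  proof (rule the_equality)
    show "pos_semidef n P \<and> P = (Qc + L\<^sup>T * R * L) + (closed_loop K)\<^sup>T * P * closed_loop K"
      using P eq by (simp add: L_def)
  next
    fix P' assume P': "pos_semidef n P' \<and>
        P' = (Qc + L\<^sup>T * R * L) + (closed_loop K)\<^sup>T * P' * closed_loop K"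
    show "P' = P"
    proof (rule lyapunov_unique[OF cl n sr W])
      show "P = (Qc + L\<^sup>T * R * L) + (closed_loop K)\<^sup>T * P * closed_loop K"
        using eq by (simp add: L_def)
    qed (use P P' in \<open>auto simp: pos_semidef_def\<close>)
  qed
qed

text \<open>
  The identity rests on \<open>G F = B\<^sup>T P A\<close>: with it the Riccati equation reads
  \<open>P = A\<^sup>T P A + Q\<^sub>c - F\<^sup>T G F\<close>, and the mixed terms \<open>L\<^sup>T G F\<close> and \<open>F\<^sup>T G L\<close> match those
  of \<open>(A - B L)\<^sup>T P (A - B L)\<close>.
\<close>

lemma riccati_completion_of_squares:
  assumes dims: "A \<in> carrier_mat n n" "B \<in> carrier_mat n m" "C \<in> carrier_mat d n"
    and Q: "pos_semidef d Q" and R: "pos_def m R"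
    and P: "riccati_solution P" and L: "L \<in> carrier_mat m n"
  defines "G \<equiv> R + B\<^sup>T * P * B"
  defines "F \<equiv> minv G * B\<^sup>T * P * A"
  shows "pos_def m G" "F \<in> carrier_mat m n"
    and "P + (L - F)\<^sup>T * G * (L - F) = Qc + L\<^sup>T * R * L + (A - B * L)\<^sup>T * P * (A - B * L)"
proof -
  have Ppsd: "pos_semidef n P"
    and ric: "P = A\<^sup>T * P * A + Qc - A\<^sup>T * P * B * minv G * B\<^sup>T * P * A"
    using P by (auto simp: riccati_solution_def G_def)
  then have Pc: "P \<in> carrier_mat n n" and Pt: "P\<^sup>T = P"
    by (auto simp: pos_semidef_def)
  have Rc: "R \<in> carrier_mat m m" using R by (simp add: pos_def_def)
  have Qcc: "Qc \<in> carrier_mat n n"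
    using Qc_pos_semidef[OF dims(3) Q] by (simp add: pos_semidef_def)
  show Gpd: "pos_def m G"
    unfolding G_def by (intro pos_def_add_pos_semidef R pos_semidef_triple[OF Ppsd dims(2)])
  note I = pos_def_minv[OF Gpd]
  have Gc: "G \<in> carrier_mat m m" and Gt: "G\<^sup>T = G"
    using Gpd by (auto simp: pos_def_def)
  show F: "F \<in> carrier_mat m n"
    unfolding F_def
    by (rule mult_carrier_mat[OF mult_carrier_mat[OF mult_carrier_mat[OF I(1)]]])
      (use dims Pc in auto)
  have GF: "G *\<^sub>v (F *\<^sub>v y) = B\<^sup>T *\<^sub>v (P *\<^sub>v (A *\<^sub>v y))" if y: "y \<in> carrier_vec n" for y
  proof -
    have w: "B\<^sup>T *\<^sub>v (P *\<^sub>v (A *\<^sub>v y)) \<in> carrier_vec m"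
      using dims Pc y by simp
    have "F *\<^sub>v y = minv G *\<^sub>v (B\<^sup>T *\<^sub>v (P *\<^sub>v (A *\<^sub>v y)))"
      unfolding F_def using dims Pc I(1) y by (simp add: mult_mat_vec_assoc_dim del: assoc_mult_mat)
    then have "G *\<^sub>v (F *\<^sub>v y) = (G * minv G) *\<^sub>v (B\<^sup>T *\<^sub>v (P *\<^sub>v (A *\<^sub>v y)))"
      using assoc_mult_mat_vec[OF Gc I(1) w] by simp
    then show ?thesis
      unfolding I(2) using w by simp
  qed
  show "P + (L - F)\<^sup>T * G * (L - F) = Qc + L\<^sup>T * R * L + (A - B * L)\<^sup>T * P * (A - B * L)"
  proof (rule mat_eq_bilinearI[of _ n n])
    fix x y :: "real vec" assume x: "x \<in> carrier_vec n" and y: "y \<in> carrier_vec n"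
    have Fy: "F *\<^sub>v y = minv G *\<^sub>v (B\<^sup>T *\<^sub>v (P *\<^sub>v (A *\<^sub>v y)))"
      unfolding F_def using dims Pc I(1) y by (simp add: mult_mat_vec_assoc_dim del: assoc_mult_mat)
    have GuF: "u \<bullet> (G *\<^sub>v (F *\<^sub>v y)) = (B *\<^sub>v u) \<bullet> (P *\<^sub>v (A *\<^sub>v y))"
      if "u \<in> carrier_vec m" "y \<in> carrier_vec n" for u y
      using that dims Pc by (simp add: GF scalar_prod_transpose_dim)
    have GFu: "(F *\<^sub>v x) \<bullet> (G *\<^sub>v u) = (A *\<^sub>v x) \<bullet> (P *\<^sub>v (B *\<^sub>v u))" if u: "u \<in> carrier_vec m" for u
    proof -
      have "(F *\<^sub>v x) \<bullet> (G *\<^sub>v u) = u \<bullet> (G *\<^sub>v (F *\<^sub>v x))"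
        by (rule symmetric_bilinear[OF Gc Gt]) (use F x u in auto)
      also have "\<dots> = (B *\<^sub>v u) \<bullet> (P *\<^sub>v (A *\<^sub>v x))"
        by (rule GuF[OF u x])
      also have "\<dots> = (A *\<^sub>v x) \<bullet> (P *\<^sub>v (B *\<^sub>v u))"
        by (rule symmetric_bilinear[OF Pc Pt]) (use dims x u in auto)
      finally show ?thesis .
    qed
    have Guv: "u \<bullet> (G *\<^sub>v v) = u \<bullet> (R *\<^sub>v v) + (B *\<^sub>v u) \<bullet> (P *\<^sub>v (B *\<^sub>v v))"
      if "u \<in> carrier_vec m" "v \<in> carrier_vec m" for u v
      unfolding G_def using that dims Pc Rc by (simp add: bilinear_simps del: assoc_mult_mat)
    have Pxy: "x \<bullet> (P *\<^sub>v y) = (A *\<^sub>v x) \<bullet> (P *\<^sub>v (A *\<^sub>v y)) + x \<bullet> (Qc *\<^sub>v y)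
        - (A *\<^sub>v x) \<bullet> (P *\<^sub>v (B *\<^sub>v (F *\<^sub>v y)))"
      unfolding Fy using dims Pc Qcc I(1) x y
      by (subst ric) (simp add: bilinear_simps del: assoc_mult_mat)
    have "x \<bullet> ((P + (L - F)\<^sup>T * G * (L - F)) *\<^sub>v y)
        = x \<bullet> (P *\<^sub>v y) + (L *\<^sub>v x) \<bullet> (G *\<^sub>v (L *\<^sub>v y)) - (L *\<^sub>v x) \<bullet> (G *\<^sub>v (F *\<^sub>v y))
          - (F *\<^sub>v x) \<bullet> (G *\<^sub>v (L *\<^sub>v y)) + (F *\<^sub>v x) \<bullet> (G *\<^sub>v (F *\<^sub>v y))"
      using Pc Gc L F x y by (simp add: bilinear_simps del: assoc_mult_mat)
    also have "\<dots> = (A *\<^sub>v x) \<bullet> (P *\<^sub>v (A *\<^sub>v y)) + x \<bullet> (Qc *\<^sub>v y)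
          + (L *\<^sub>v x) \<bullet> (R *\<^sub>v (L *\<^sub>v y)) + (B *\<^sub>v (L *\<^sub>v x)) \<bullet> (P *\<^sub>v (B *\<^sub>v (L *\<^sub>v y)))
          - (B *\<^sub>v (L *\<^sub>v x)) \<bullet> (P *\<^sub>v (A *\<^sub>v y)) - (A *\<^sub>v x) \<bullet> (P *\<^sub>v (B *\<^sub>v (L *\<^sub>v y)))"
    proof -
      have c: "L *\<^sub>v x \<in> carrier_vec m" "L *\<^sub>v y \<in> carrier_vec m" "F *\<^sub>v y \<in> carrier_vec m"
        using L F x y by auto
      show ?thesis
        using Pxy Guv[OF c(1,2)] GuF[OF c(1) y] GFu[OF c(2)] GFu[OF c(3)] by linarith
    qed
    also have "\<dots> = x \<bullet> ((Qc + L\<^sup>T * R * L + (A - B * L)\<^sup>T * P * (A - B * L)) *\<^sub>v y)"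
      using dims Pc Rc Qcc L x y by (simp add: bilinear_simps del: assoc_mult_mat)
    finally show "x \<bullet> ((P + (L - F)\<^sup>T * G * (L - F)) *\<^sub>v y)
      = x \<bullet> ((Qc + L\<^sup>T * R * L + (A - B * L)\<^sup>T * P * (A - B * L)) *\<^sub>v y)" .
  qed (use dims Pc Gc Rc Qcc L F in auto)
qed

end

theorem theorem4:
  fixes n m d :: nat
    and A B C Q R \<Sigma>0 Pstar Kstar K :: "real mat"
    and M :: "'w measure" and x0 :: "'w \<Rightarrow> real vec"
  assumes "n > 0" "m > 0" "d > 0"
    and "A \<in> carrier_mat n n" "B \<in> carrier_mat n m" "C \<in> carrier_mat d n"
    and "io_lqr.controllable n m A B"
    and "io_lqr.observable n d A C"
    and "pos_semidef d Q" "pos_def m R"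
    and "prob_space M" "centered_random_vec n M x0"
    and "\<Sigma>0 = covariance_mat n M x0" "pos_def n \<Sigma>0"
    and Pstar_solution: "io_lqr.riccati_solution n A B C Q R Pstar"
    and Pstar_unique: "\<And>P. io_lqr.riccati_solution n A B C Q R P \<Longrightarrow> P = Pstar"
    and Kstar: "Kstar = io_lqr.riccati_gain n m d A B C R Pstar"
    and Kstar_feasible: "Kstar \<in> io_lqr.feasible n m d A B C"
  shows "io_lqr.optimal_policy n m d A B C Q R \<Sigma>0 K \<longleftrightarrow>
         K \<in> io_lqr.policy_family n m d A B C Kstar"
proof -
  interpret io_lqr n m d A B C Q R \<Sigma>0 .
  note n = \<open>n > 0\<close> and A = \<open>A \<in> carrier_mat n n\<close> and B = \<open>B \<in> carrier_mat n m\<close>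
    and C = \<open>C \<in> carrier_mat d n\<close> and Q = \<open>pos_semidef d Q\<close> and R = \<open>pos_def m R\<close>
    and cv = \<open>centered_random_vec n M x0\<close> and \<Sigma> = \<open>\<Sigma>0 = covariance_mat n M x0\<close>
  note Sp = S_right_inverse(1)[OF A \<open>controllable\<close>] and SSp = S_right_inverse(2)[OF A \<open>controllable\<close>]
  define G where "G = R + B\<^sup>T * Pstar * B"
  define F where "F = minv G * B\<^sup>T * Pstar * A"
  note square = riccati_completion_of_squares[OF A B C Q R Pstar_solution, folded G_def, folded F_def]
  have Ppsd: "pos_semidef n Pstar"
    using Pstar_solution by (simp add: riccati_solution_def)
  have Pc: "Pstar \<in> carrier_mat n n"
    using Ppsd by (simp add: pos_semidef_def)
  have Gpd: "pos_def m G" and F: "F \<in> carrier_mat m n"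
    using square(1,2)[OF zero_carrier_mat] by auto
  have Gc: "G \<in> carrier_mat m m" using Gpd by (simp add: pos_def_def)
  have Kstar_eq: "Kstar = F * S"
    using Kstar by (simp add: riccati_gain_def F_def G_def)
  have Kstar_c: "Kstar \<in> carrier_mat m q"
    unfolding Kstar_eq using F S_carrier by (rule mult_carrier_mat)
  have KstarSp: "Kstar * S_pinv = F"
    unfolding Kstar_eq assoc_mult_mat[OF F S_carrier Sp] SSp using F by simp
  \<comment> \<open>The remainder \<open>D\<close> here is \<open>T\<^sup>T D' T\<close> for the solution \<open>D'\<close> of \<open>D' = W + T\<^sup>T D' T\<close>, so the cost
    matrix exceeds \<open>P\<^sup>*\<close> by at least \<open>W\<close>.\<close>
  have cost: "\<exists>D. pos_semidef n D \<and> cost_mat K' = Pstar + ((K' * S_pinv - F)\<^sup>T * G * (K' * S_pinv - F) + D)"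
    if K': "K' \<in> feasible" for K'
  proof -
    have K'c: "K' \<in> carrier_mat m q" and sr: "spec_rad (closed_loop K') < 1"
      using K' by (auto simp: feasible_def)
    define L where "L = K' * S_pinv"
    have L: "L \<in> carrier_mat m n"
      unfolding L_def using K'c Sp by (rule mult_carrier_mat)
    define T where "T = closed_loop K'"
    have T: "T = A - B * L"
      unfolding T_def L_def by (rule closed_loop_eq[OF B K'c Sp])
    have Tc: "T \<in> carrier_mat n n"
      unfolding T using mult_carrier_mat[OF B L] by (rule minus_carrier_mat)
    define W where "W = (L - F)\<^sup>T * G * (L - F)"
    have Wpsd: "pos_semidef n W"
      unfolding W_def
      by (rule pos_semidef_triple[OF pos_def_imp_pos_semidef[OF Gpd] minus_carrier_mat[OF F]])
    obtain D where D: "pos_semidef n D" "D = W + T\<^sup>T * D * T"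
      by (rule lyapunov_exists[OF Tc n sr[folded T_def] Wpsd]) (rule that)
    have cars: "W \<in> carrier_mat n n" "D \<in> carrier_mat n n"
      using Wpsd D(1) by (auto simp: pos_semidef_def)
    have car2: "T\<^sup>T * D * T \<in> carrier_mat n n" "T\<^sup>T * Pstar * T \<in> carrier_mat n n"
      "L\<^sup>T * R * L \<in> carrier_mat n n" "Qc \<in> carrier_mat n n"
      using Tc cars Pc L R Qc_pos_semidef[OF C Q] by (auto simp: pos_def_def pos_semidef_def)
    have sq: "Pstar + W = Qc + L\<^sup>T * R * L + T\<^sup>T * Pstar * T"
      unfolding W_def T by (rule square(3)[OF L])
    have "cost_mat K' = Pstar + D"
    proof (rule cost_mat_eqI[OF n A B C Q R Sp K'])
      show "pos_semidef n (Pstar + D)"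
        by (rule pos_semidef_add[OF Ppsd D(1)])
      have "Pstar + D = (Pstar + W) + T\<^sup>T * D * T"
        by (subst D(2)) (rule assoc_add_mat[OF Pc cars(1) car2(1), symmetric])
      also have "\<dots> = Qc + L\<^sup>T * R * L + (T\<^sup>T * Pstar * T + T\<^sup>T * D * T)"
        unfolding sq by (rule assoc_add_mat[OF add_carrier_mat[OF car2(3)] car2(2,1)])
      also have "T\<^sup>T * Pstar * T + T\<^sup>T * D * T = T\<^sup>T * (Pstar + D) * T"
      proof (rule mat_eq_bilinearI[OF add_carrier_mat[OF car2(1)]])
        show "T\<^sup>T * (Pstar + D) * T \<in> carrier_mat n n"
          using pos_semidef_triple[OF pos_semidef_add[OF Ppsd D(1)] Tc] by (simp add: pos_semidef_def)
      qed (use Tc Pc cars(2) in \<open>simp add: bilinear_simps del: assoc_mult_mat\<close>)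
      finally show "Pstar + D = Qc + (K' * S_pinv)\<^sup>T * R * (K' * S_pinv)
          + (closed_loop K')\<^sup>T * (Pstar + D) * closed_loop K'"
        by (simp only: T_def L_def)
    qed
    moreover have "pos_semidef n (T\<^sup>T * D * T)"
      by (rule pos_semidef_triple[OF D(1) Tc])
    ultimately show ?thesis
      using D(2) unfolding L_def[symmetric] W_def[symmetric] by metis
  qed
  have tr_add: "tr ((X + Y) * \<Sigma>0) = tr (X * \<Sigma>0) + tr (Y * \<Sigma>0)"
    if "X \<in> carrier_mat n n" "Y \<in> carrier_mat n n" for X Y
  proof -
    have "\<Sigma>0 \<in> carrier_mat n n" by (simp add: \<Sigma> covariance_mat_def)
    then show ?thesis
      using that add_mult_distrib_mat[OF that] by (simp add: tr_def sum.distrib)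
  qed
  have gap: "J K' \<ge> tr (Pstar * \<Sigma>0) + tr ((K' * S_pinv - F)\<^sup>T * G * (K' * S_pinv - F) * \<Sigma>0)"
    if K': "K' \<in> feasible" for K'
  proof -
    let ?W = "(K' * S_pinv - F)\<^sup>T * G * (K' * S_pinv - F)"
    obtain D where D: "pos_semidef n D" "cost_mat K' = Pstar + (?W + D)"
      using cost[OF K'] by blast
    have Dc: "D \<in> carrier_mat n n" using D(1) by (simp add: pos_semidef_def)
    have Wc: "?W \<in> carrier_mat n n"
      using minus_carrier_mat[OF F] Gc by (metis mult_carrier_mat transpose_carrier_mat)
    have "J K' = tr (Pstar * \<Sigma>0) + (tr (?W * \<Sigma>0) + tr (D * \<Sigma>0))"
      unfolding J_def D(2) tr_add[OF Pc add_carrier_mat[OF Dc]] tr_add[OF Wc Dc] ..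
    moreover have "tr (D * \<Sigma>0) \<ge> 0"
      unfolding \<Sigma> by (rule trace_covariance_nonneg[OF cv D(1)])
    ultimately show ?thesis by simp
  qed
  have gap_nonneg: "tr ((K' * S_pinv - F)\<^sup>T * G * (K' * S_pinv - F) * \<Sigma>0) \<ge> 0" for K'
    unfolding \<Sigma>
    by (intro trace_covariance_nonneg[OF cv] pos_semidef_triple[OF pos_def_imp_pos_semidef[OF Gpd]]
        minus_carrier_mat[OF F])
  have cl_F: "closed_loop K' = closed_loop Kstar" if "K' \<in> carrier_mat m q" "K' * S_pinv = F" for K'
    unfolding closed_loop_eq[OF B that(1) Sp] closed_loop_eq[OF B Kstar_c Sp] that(2) KstarSp ..
  have J_F: "J K' = tr (Pstar * \<Sigma>0)" if K': "K' \<in> feasible" "K' * S_pinv = F" for K'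
  proof -
    have K'c: "K' \<in> carrier_mat m q" using K' by (simp add: feasible_def)
    have "Pstar + (F - F)\<^sup>T * G * (F - F) = Pstar"
    proof -
      have "F - F = 0\<^sub>m m n" using F by auto
      then show ?thesis using Gc Pc by simp
    qed
    then have "Pstar = Qc + F\<^sup>T * R * F + (A - B * F)\<^sup>T * Pstar * (A - B * F)"
      using square(3)[OF F] by simp
    then have "cost_mat K' = Pstar"
      by (intro cost_mat_eqI[OF n A B C Q R Sp K'(1) Ppsd])
        (simp only: K'(2) closed_loop_eq[OF B K'c Sp])
    then show ?thesis by (simp add: J_def)
  qed
  have optimal_iff: "optimal_policy K \<longleftrightarrow> K \<in> carrier_mat m q \<and> K * S_pinv = F"
  proof
    assume opt: "optimal_policy K"
    then have K: "K \<in> feasible" and "J K \<le> J Kstar"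
      using Kstar_feasible by (auto simp: optimal_policy_def)
    then have Kc: "K \<in> carrier_mat m q" and le: "J K \<le> tr (Pstar * \<Sigma>0)"
      using J_F[OF Kstar_feasible KstarSp] by (auto simp: feasible_def)
    have tr0: "tr ((K * S_pinv - F)\<^sup>T * G * (K * S_pinv - F) * covariance_mat n M x0) = 0"
      using gap[OF K] gap_nonneg[of K] le unfolding \<Sigma> by linarith
    have "K * S_pinv - F = 0\<^sub>m m n"
      by (rule trace_covariance_eq_0[OF cv _ Gpd minus_carrier_mat[OF F] tr0])
        (use \<open>pos_def n \<Sigma>0\<close> \<Sigma> in simp)
    then have "K * S_pinv = F"
      by (rule minus_mat_eq_0D[OF mult_carrier_mat[OF Kc Sp] F])
    with Kc show "K \<in> carrier_mat m q \<and> K * S_pinv = F" by blast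
  next
    assume K: "K \<in> carrier_mat m q \<and> K * S_pinv = F"
    then have Kf: "K \<in> feasible"
      using cl_F[of K] Kstar_feasible by (simp add: feasible_def)
    have "J K \<le> J K'" if "K' \<in> feasible" for K'
      using J_F[OF Kf] K gap[OF that] gap_nonneg[of K'] by simp
    with Kf show "optimal_policy K" by (simp add: optimal_policy_def)
  qed
  have family_iff: "K \<in> policy_family Kstar \<longleftrightarrow> K \<in> carrier_mat m q \<and> K * S_pinv = F"
  proof
    assume "K \<in> policy_family Kstar"
    then obtain \<Delta> where Kc: "K \<in> carrier_mat m q" and \<Delta>: "\<Delta> \<in> carrier_mat m q"
      "\<Delta> * S_pinv = 0\<^sub>m m n" "K = Kstar + \<Delta>"
      by (auto simp: policy_family_def null_policies_def)
    have "K * S_pinv = F"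
      unfolding \<Delta>(3) add_mult_distrib_mat[OF Kstar_c \<Delta>(1) Sp] KstarSp \<Delta>(2) using F by simp
    with Kc show "K \<in> carrier_mat m q \<and> K * S_pinv = F" by blast
  next
    assume K: "K \<in> carrier_mat m q \<and> K * S_pinv = F"
    then have Kc: "K \<in> carrier_mat m q" by blast
    have "(K - Kstar) * S_pinv = 0\<^sub>m m n"
      unfolding minus_mult_distrib_mat[OF Kc Kstar_c Sp] KstarSp using K F by auto
    then have "K - Kstar \<in> null_policies"
      using Kstar_c by (simp add: null_policies_def minus_carrier_mat)
    moreover have "K = Kstar + (K - Kstar)"
      using Kc Kstar_c by (intro eq_matI) auto
    ultimately show "K \<in> policy_family Kstar"
      using Kc by (auto simp: policy_family_def)
  qed
  show ?thesis
    using optimal_iff family_iff by blast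
qed

end
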